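(* Every computably approximable real in $(0,1)$ is c.a. speedable, i.e. has a computable approximation that is speedable.
   Context: Conventions: "real" means a real number in the open interval $(0,1)$. An approximation of a real $\alpha$ is a sequence $\{a_s\}_{s\in\omega}$ of rational numbers in $[0,1]$ converging to $\alpha$. It is computable if $a_s$ can be computed from $s$. A real is computably approximable (c.a.) if it has a computable approximation. A computable order is a computable function $f:\mathbb N\to\mathbb N$ that is nondecreasing and unbounded. Let $\{a_s\}_{s\in\omega}$ be a computable approximation of $\alpha$ and let $\rho\in[0,1)$ be rational. The approximation is $\rho$-speedable if either $\alpha$ is rational, or $\alpha$ is irrational and there is a computable order $f$ with $$\liminf_{s\to\infty}\left|\frac{\alpha-a_{f(s)}}{\alpha-a_s}\right|\le\rho .$$ It is speedable if it is $\rho$-speedable for some $\rho\in[0,1)$. *)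

theory Defs
  imports Complex_Main "HOL-Library.Extended_Real"
begin

text \<open>
  Total recursive functions: the least class that contains the zero functions, successor and
  projections and is closed under composition, primitive recursion and regular minimisation
  (minimisation is applied only where a zero exists for all arguments, so every function in the
  class is total). In \<^term>\<open>recursive_fn n F\<close> the argument list stands for an
  \<^term>\<open>n\<close>-tuple; the values of \<^term>\<open>F\<close> on lists of other lengths are junk.
\<close>

inductive recursive_fn :: "nat \<Rightarrow> (nat list \<Rightarrow> nat) \<Rightarrow> bool" where
  zero: "recursive_fn n (\<lambda>xs. 0)"
| succ: "recursive_fn 1 (\<lambda>xs. Suc (hd xs))"
| proj: "i < n \<Longrightarrow> recursive_fn n (\<lambda>xs. xs ! i)"
| comp: "recursive_fn (length Gs) F \<Longrightarrow> (\<forall>G\<in>set Gs. recursive_fn n G) \<Longrightarrow>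
    recursive_fn n (\<lambda>xs. F (map (\<lambda>G. G xs) Gs))"
| prim_rec: "recursive_fn n G \<Longrightarrow> recursive_fn (n + 2) H \<Longrightarrow>
    recursive_fn (n + 1) (\<lambda>xs. rec_nat (G (tl xs)) (\<lambda>y r. H (y # r # tl xs)) (hd xs))"
| minim: "recursive_fn (n + 1) G \<Longrightarrow> (\<forall>xs. length xs = n \<longrightarrow> (\<exists>y. G (y # xs) = 0)) \<Longrightarrow>
    recursive_fn n (\<lambda>xs. LEAST y. G (y # xs) = 0)"

definition computable :: "(nat \<Rightarrow> nat) \<Rightarrow> bool" where
  "computable f \<longleftrightarrow> (\<exists>F. recursive_fn 1 F \<and> (\<forall>x. f x = F [x]))"

text \<open>Sign, numerator and denominator can be computed; the fraction need not be reduced.\<close>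

definition computable_rat_seq :: "(nat \<Rightarrow> rat) \<Rightarrow> bool" where
  "computable_rat_seq a \<longleftrightarrow>
    (\<exists>\<sigma> p q. computable \<sigma> \<and> computable p \<and> computable q \<and>
      (\<forall>s. q s > 0 \<and> a s = (- 1) ^ \<sigma> s * of_nat (p s) / of_nat (q s)))"

definition approximation :: "(nat \<Rightarrow> rat) \<Rightarrow> real \<Rightarrow> bool" where
  "approximation a \<alpha> \<longleftrightarrow> (\<forall>s. a s \<in> {0..1}) \<and> (\<lambda>s. of_rat (a s)) \<longlonglongrightarrow> \<alpha>"

definition computable_approximation :: "(nat \<Rightarrow> rat) \<Rightarrow> real \<Rightarrow> bool" where
  "computable_approximation a \<alpha> \<longleftrightarrow> approximation a \<alpha> \<and> computable_rat_seq a"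

definition computably_approximable :: "real \<Rightarrow> bool" where
  "computably_approximable \<alpha> \<longleftrightarrow> (\<exists>a. computable_approximation a \<alpha>)"

definition computable_order :: "(nat \<Rightarrow> nat) \<Rightarrow> bool" where
  "computable_order f \<longleftrightarrow> computable f \<and> mono f \<and> (\<forall>n. \<exists>s. n \<le> f s)"

text \<open>
  The limit inferior is taken in the extended reals, since the quotients may be unbounded. For
  irrational \<^term>\<open>\<alpha>\<close> the denominators do not vanish. The notion is meant for computable
  approximations \<^term>\<open>a\<close> of \<^term>\<open>\<alpha>\<close>.
\<close>

definition rho_speedable :: "rat \<Rightarrow> (nat \<Rightarrow> rat) \<Rightarrow> real \<Rightarrow> bool" where
  "rho_speedable \<rho> a \<alpha> \<longleftrightarrow>
    \<alpha> \<in> \<rat> \<or>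
    (\<alpha> \<notin> \<rat> \<and>
      (\<exists>f. computable_order f \<and>
        liminf (\<lambda>s. ereal \<bar>(\<alpha> - of_rat (a (f s))) / (\<alpha> - of_rat (a s))\<bar>) \<le> ereal (of_rat \<rho>)))"

definition speedable :: "(nat \<Rightarrow> rat) \<Rightarrow> real \<Rightarrow> bool" where
  "speedable a \<alpha> \<longleftrightarrow> (\<exists>\<rho>\<in>{0..<1}. rho_speedable \<rho> a \<alpha>)"

definition ca_speedable :: "real \<Rightarrow> bool" where
  "ca_speedable \<alpha> \<longleftrightarrow> (\<exists>a. computable_approximation a \<alpha> \<and> speedable a \<alpha>)"

end

theory Submission imports Defs
begin

text \<open>
  Perturb the approximation so that one step back to the unperturbed value is a speed-up. Let
  \<open>n\<^sub>s\<close> be the least \<open>n\<close> for which \<open>a\<^sub>s\<close> and \<open>a\<^sub>s\<^sub>+\<^sub>1\<close> lie in different cells of the grid of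
  mesh \<open>1/(n+1)\<close>, cut off at \<open>s\<close>. For irrational \<open>\<alpha>\<close> every grid sees only finitely many changes of
  cell, so \<open>n\<^sub>s\<close> tends to infinity. If \<open>s\<close> is the last stage with \<open>n\<^sub>s \<le> N\<close>, then \<open>a\<^sub>s\<^sub>+\<^sub>1\<close> is
  already in the final cell of mesh \<open>1/(N+1)\<close>, so its distance to \<open>\<alpha>\<close> is at most \<open>1/(n\<^sub>s+1)\<close>.
  Listing \<open>a\<^sub>s\<^sub>+\<^sub>1 + 3/(n\<^sub>s+1)\<close> just before \<open>a\<^sub>s\<^sub>+\<^sub>1\<close> thus halves the distance to \<open>\<alpha>\<close> infinitely
  often, with the order \<open>f(t) = t + 1\<close>.
\<close>

section \<open>Total recursive functions\<close>

text \<open>Closes \<^const>\<open>recursive_fn\<close> under changing the junk values on lists of the wrong length.\<close>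

definition recursive :: "nat \<Rightarrow> (nat list \<Rightarrow> nat) \<Rightarrow> bool" where
  "recursive n F \<longleftrightarrow> (\<exists>F'. recursive_fn n F' \<and> (\<forall>xs. length xs = n \<longrightarrow> F xs = F' xs))"

lemma recursive_fn_imp_recursive: "recursive_fn n F \<Longrightarrow> recursive n F"
  unfolding recursive_def by blast

lemma recursive_cong:
  assumes "recursive n F" and "\<And>xs. length xs = n \<Longrightarrow> F xs = G xs"
  shows "recursive n G"
  using assms unfolding recursive_def by metis

text \<open>This makes the closure rules for \<open>recursive\<close> available for
  \<open>computable\<close>; writing the argument as \<open>xs ! 0\<close> matches the
  projections.\<close>

lemma computable_iff_recursive: "computable f \<longleftrightarrow> recursive 1 (\<lambda>xs. f (xs ! 0))"
proof
  assume "computable f"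
  then obtain F where F: "recursive_fn 1 F" "\<And>x. f x = F [x]"
    unfolding computable_def by blast
  show "recursive 1 (\<lambda>xs. f (xs ! 0))"
    by (rule recursive_cong[OF recursive_fn_imp_recursive[OF F(1)]])
      (auto simp: F(2) length_Suc_conv)
next
  assume "recursive 1 (\<lambda>xs. f (xs ! 0))"
  then obtain F where F: "recursive_fn 1 F"
    and eq: "\<And>xs. length xs = 1 \<Longrightarrow> f (xs ! 0) = F xs"
    unfolding recursive_def by blast
  have "f x = F [x]" for x
    using eq[of "[x]"] by simp
  with F show "computable f"
    unfolding computable_def by blast
qed

lemma recursive_comp:
  assumes "recursive (length Gs) F" and "\<forall>G\<in>set Gs. recursive n G"
  shows "recursive n (\<lambda>xs. F (map (\<lambda>G. G xs) Gs))"
proof -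
  obtain F' where F': "recursive_fn (length Gs) F'"
    and F_eq: "\<And>xs. length xs = length Gs \<Longrightarrow> F xs = F' xs"
    using assms(1) unfolding recursive_def by blast
  obtain h where h: "\<And>G. G \<in> set Gs \<Longrightarrow> recursive_fn n (h G)"
    and G_eq: "\<And>G xs. G \<in> set Gs \<Longrightarrow> length xs = n \<Longrightarrow> G xs = h G xs"
    using assms(2) unfolding recursive_def by metis
  have "recursive_fn n (\<lambda>xs. F' (map (\<lambda>G. G xs) (map h Gs)))"
    using F' h by (intro recursive_fn.comp) auto
  moreover have "F (map (\<lambda>G. G xs) Gs) = F' (map (\<lambda>G. G xs) (map h Gs))" if "length xs = n" for xs
  proof -
    have "map (\<lambda>G. G xs) (map h Gs) = map (\<lambda>G. G xs) Gs"
      using G_eq[OF _ that] by simp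
    then show ?thesis
      by (simp only: F_eq length_map)
  qed
  ultimately show ?thesis
    unfolding recursive_def by blast
qed

lemma recursive_comp1:
  assumes "recursive 1 (\<lambda>xs. f (xs ! 0))" and "recursive n F"
  shows "recursive n (\<lambda>xs. f (F xs))"
  using recursive_comp[of "[F]" "\<lambda>xs. f (xs ! 0)" n] assms by simp

lemma recursive_comp2:
  assumes "recursive 2 (\<lambda>xs. f (xs ! 0) (xs ! 1))" and "recursive n F" and "recursive n G"
  shows "recursive n (\<lambda>xs. f (F xs) (G xs))"
  using recursive_comp[of "[F, G]" "\<lambda>xs. f (xs ! 0) (xs ! 1)" n] assms
  by (simp add: numeral_2_eq_2)

lemma recursive_proj: "i < n \<Longrightarrow> recursive n (\<lambda>xs. xs ! i)"
  by (intro recursive_fn_imp_recursive recursive_fn.proj)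

lemma recursive_Suc:
  assumes "recursive n F"
  shows "recursive n (\<lambda>xs. Suc (F xs))"
proof (rule recursive_comp1[OF _ assms])
  show "recursive 1 (\<lambda>xs. Suc (xs ! 0))"
    by (rule recursive_cong[OF recursive_fn_imp_recursive[OF recursive_fn.succ]])
      (auto simp: length_Suc_conv)
qed

lemma recursive_const: "recursive n (\<lambda>xs. c)"
  by (induction c) (auto intro: recursive_Suc recursive_fn_imp_recursive recursive_fn.zero)

lemma recursive_rec_nat:
  assumes "recursive n G" and "recursive (n + 2) H"
  shows "recursive (n + 1) (\<lambda>xs. rec_nat (G (tl xs)) (\<lambda>y r. H (y # r # tl xs)) (hd xs))"
proof -
  obtain G' where G': "recursive_fn n G'" "\<And>xs. length xs = n \<Longrightarrow> G xs = G' xs"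
    using assms(1) unfolding recursive_def by blast
  obtain H' where H': "recursive_fn (n + 2) H'" "\<And>xs. length xs = n + 2 \<Longrightarrow> H xs = H' xs"
    using assms(2) unfolding recursive_def by blast
  show ?thesis
    by (rule recursive_cong[OF recursive_fn_imp_recursive[OF recursive_fn.prim_rec[OF G'(1) H'(1)]]])
      (simp add: G'(2) H'(2))
qed

text \<open>The form used for the arithmetic operations below: the recursion runs on argument 0, and
  argument 1 is a fixed parameter.\<close>

lemma recursive_rec_nat2:
  assumes "recursive 1 (\<lambda>xs. g (xs ! 0))"
    and "recursive 3 (\<lambda>xs. h (xs ! 0) (xs ! 1) (xs ! 2))"
  shows "recursive 2 (\<lambda>xs. rec_nat (g (xs ! 1)) (\<lambda>y r. h y r (xs ! 1)) (xs ! 0))"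
proof -
  have "recursive (1 + 2) (\<lambda>xs. h (xs ! 0) (xs ! 1) (xs ! 2))"
    using assms(2) by (simp add: numeral_3_eq_3)
  from recursive_rec_nat[OF assms(1) this]
  have "recursive 2 (\<lambda>xs. rec_nat (g (tl xs ! 0)) (\<lambda>y r. h y r (tl xs ! 0)) (hd xs))"
    by (simp add: numeral_2_eq_2)
  then show ?thesis
    by (rule recursive_cong) (auto simp: length_Suc_conv numeral_2_eq_2)
qed

lemma recursive_Least:
  assumes "recursive (Suc n) G" and "\<And>xs. length xs = n \<Longrightarrow> \<exists>y. G (y # xs) = 0"
  shows "recursive n (\<lambda>xs. LEAST y. G (y # xs) = 0)"
proof -
  obtain G' where G': "recursive_fn (Suc n) G'" "\<And>xs. length xs = Suc n \<Longrightarrow> G xs = G' xs"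
    using assms(1) unfolding recursive_def by blast
  have "recursive_fn n (\<lambda>xs. LEAST y. G' (y # xs) = 0)"
    using assms(2) G' by (intro recursive_fn.minim) auto
  then show ?thesis
    by (rule recursive_cong[OF recursive_fn_imp_recursive]) (simp add: G'(2))
qed

section \<open>Arithmetic on natural numbers\<close>

lemma recursive_add:
  assumes "recursive n F" and "recursive n G"
  shows "recursive n (\<lambda>xs. F xs + G xs)"
proof (rule recursive_comp2[OF _ assms])
  have eq: "rec_nat y (\<lambda>_ r. Suc r) x = x + y" for x y :: nat
    by (induction x) auto
  show "recursive 2 (\<lambda>xs. xs ! 0 + xs ! 1)"
    using recursive_rec_nat2[of "\<lambda>y. y" "\<lambda>_ r _. Suc r"]
    by (simp add: eq recursive_proj recursive_Suc)
qed

lemma recursive_mult: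
  assumes "recursive n F" and "recursive n G"
  shows "recursive n (\<lambda>xs. F xs * G xs)"
proof (rule recursive_comp2[OF _ assms])
  have eq: "rec_nat 0 (\<lambda>_ r. r + y) x = x * y" for x y :: nat
    by (induction x) auto
  show "recursive 2 (\<lambda>xs. xs ! 0 * xs ! 1)"
    using recursive_rec_nat2[of "\<lambda>y. 0" "\<lambda>_ r y. r + y"]
    by (simp add: eq recursive_proj recursive_const recursive_add)
qed

lemma recursive_pred:
  assumes "recursive n F"
  shows "recursive n (\<lambda>xs. F xs - 1)"
proof (rule recursive_comp1[OF _ assms])
  have eq: "rec_nat 0 (\<lambda>y r. y) x = x - 1" for x :: nat
    by (cases x) auto
  have "recursive 2 (\<lambda>xs. xs ! 0 - 1)"
    using recursive_rec_nat2[of "\<lambda>y. 0" "\<lambda>x _ _. x"]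
    by (simp add: eq recursive_proj recursive_const)
  \<comment> \<open>The recursion scheme carries a parameter that the predecessor ignores; feeding
    argument 0 into both places removes it.\<close>
  from recursive_comp2[OF this recursive_proj recursive_proj, of 0 1 0]
  show "recursive 1 (\<lambda>xs. xs ! 0 - 1)"
    by simp
qed

lemma recursive_diff:
  assumes "recursive n F" and "recursive n G"
  shows "recursive n (\<lambda>xs. F xs - G xs)"
\<comment> \<open>The recursion is on the subtrahend, which must come first, so the arguments are
  swapped.\<close>
proof (rule recursive_comp2[OF _ assms(2,1), of "\<lambda>x y. y - x"])
  have eq: "rec_nat y (\<lambda>_ r. r - 1) x = y - x" for x y :: nat
    by (induction x) auto
  show "recursive 2 (\<lambda>xs. xs ! 1 - xs ! 0)"
    using recursive_rec_nat2[of "\<lambda>y. y" "\<lambda>_ r _. r - 1", OF recursive_proj recursive_pred[OF recursive_proj]]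
    by (simp add: eq del: One_nat_def)
qed

lemma recursive_min:
  assumes "recursive n F" and "recursive n G"
  shows "recursive n (\<lambda>xs. min (F xs) (G xs))"
proof -
  have eq: "min x y = x - (x - y)" for x y :: nat
    by simp
  show ?thesis
    unfolding eq by (intro recursive_diff assms)
qed

text \<open>The quotient of \<open>x\<close> by \<open>y\<close> is the least \<open>z\<close> with
  \<open>x < Suc z * y\<close>. For \<open>y = 0\<close> the search must still succeed, and at 0,
  since \<open>x div 0 = 0\<close>.\<close>

lemma recursive_div:
  assumes "recursive n F" and "recursive n G"
  shows "recursive n (\<lambda>xs. F xs div G xs)"
proof (rule recursive_comp2[OF _ assms])
  \<comment> \<open>Argument 0 is the candidate, 1 the dividend, 2 the divisor. The outer factor
    makes \<open>?H\<close> vanish everywhere when the divisor is 0.\<close>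
  let ?H = "\<lambda>xs::nat list. xs ! 2 * (Suc (xs ! 1) - Suc (xs ! 0) * xs ! 2)"
  have H0: "?H (z # xs) = 0 \<longleftrightarrow> xs ! 1 = 0 \<or> xs ! 0 < Suc z * xs ! 1" for z xs
    by (auto simp: numeral_2_eq_2)
  have "recursive 2 (\<lambda>xs. LEAST z. ?H (z # xs) = 0)"
  proof (rule recursive_Least)
    show "recursive (Suc 2) ?H"
      by (intro recursive_mult recursive_diff recursive_Suc recursive_proj) auto
    show "\<exists>z. ?H (z # xs) = 0" for xs
      unfolding H0 by (cases "xs ! 1") (auto intro!: exI[of _ "xs ! 0"])
  qed
  moreover have "(LEAST z. y = 0 \<or> x < Suc z * y) = x div y" for x y :: nat
  proof (rule Least_equality)
    show "y = 0 \<or> x < Suc (x div y) * y"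
      using dividend_less_div_times[of y x] by (auto simp: algebra_simps)
    show "x div y \<le> z" if "y = 0 \<or> x < Suc z * y" for z
      using that less_mult_imp_div_less[of x "Suc z" y] by (cases "y = 0") auto
  qed
  ultimately show "recursive 2 (\<lambda>xs. xs ! 0 div xs ! 1)"
    unfolding H0 by simp
qed

lemma recursive_mod:
  assumes "recursive n F" and "recursive n G"
  shows "recursive n (\<lambda>xs. F xs mod G xs)"
  unfolding minus_div_mult_eq_mod[symmetric] by (intro recursive_diff recursive_mult recursive_div assms)

lemmas recursive_intros =
  recursive_Suc recursive_const recursive_add recursive_mult recursive_diff recursive_min
  recursive_div recursive_mod

section \<open>The perturbed approximation\<close>

text \<open>The alternative \<open>s \<le> n\<close> bounds the search, so a least \<open>n\<close>
  exists even if \<open>a s\<close> and \<open>a (Suc s)\<close> coincide.\<close>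

definition grid_change :: "(nat \<Rightarrow> rat) \<Rightarrow> nat \<Rightarrow> nat" where
  "grid_change a s =
    (LEAST n. s \<le> n \<or> \<lfloor>of_nat (Suc n) * a (Suc s)\<rfloor> \<noteq> \<lfloor>of_nat (Suc n) * a s\<rfloor>)"

text \<open>Truncation at 1 keeps the values in the unit interval; the shift is positive, so no
  truncation at 0 is called for.\<close>

definition perturbed :: "(nat \<Rightarrow> rat) \<Rightarrow> nat \<Rightarrow> rat" where
  "perturbed a t = (let s = t div 2 in
    if even t then min 1 (a (Suc s) + 3 / of_nat (Suc (grid_change a s))) else a (Suc s))"

lemma grid_change_le: "grid_change a s \<le> s"
  unfolding grid_change_def by (rule Least_le) simp

lemma floor_eq_if_less_grid_change:
  "n < grid_change a s \<Longrightarrow> \<lfloor>of_nat (Suc n) * a (Suc s)\<rfloor> = \<lfloor>of_nat (Suc n) * a s\<rfloor>"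
  unfolding grid_change_def by (drule not_less_Least) simp

lemma grid_change_cases:
  "s \<le> grid_change a s \<or> (let n = grid_change a s in
    \<lfloor>of_nat (Suc n) * a (Suc s)\<rfloor> \<noteq> \<lfloor>of_nat (Suc n) * a s\<rfloor>)"
  unfolding grid_change_def Let_def by (rule LeastI[of _ s]) simp

text \<open>The floors are integer quotients of natural numbers, so the search condition is
  recursive and minimisation applies.\<close>

lemma computable_grid_change:
  assumes "computable p" and "computable q"
    and a: "\<And>s. a s = of_nat (p s) / of_nat (q s)"
  shows "computable (grid_change a)"
proof -
  define g where "g n s = Suc n * p s div q s" for n s
  \<comment> \<open>Argument 0 is the candidate, 1 the stage. The first factor vanishes at the
    cutoff; the second vanishes when the quotients differ, the sum of both truncated differences
    being their distance.\<close>
  let ?H = "\<lambda>xs. (xs ! 1 - xs ! 0) * (1 -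
    ((g (xs ! 0) (Suc (xs ! 1)) - g (xs ! 0) (xs ! 1)) +
     (g (xs ! 0) (xs ! 1) - g (xs ! 0) (Suc (xs ! 1)))))"
  have floor: "\<lfloor>of_nat (Suc n) * a s\<rfloor> = int (g n s)" for n s
    unfolding a g_def times_divide_eq_right of_nat_mult[symmetric] floor_divide_of_nat_eq ..
  have pq: "recursive n (\<lambda>xs. p (F xs))" "recursive n (\<lambda>xs. q (F xs))" if "recursive n F" for n F
    using recursive_comp1[OF _ that] assms(1,2) unfolding computable_iff_recursive by blast+
  have H0: "?H (z # xs) = 0 \<longleftrightarrow> xs ! 0 \<le> z \<or> g z (Suc (xs ! 0)) \<noteq> g z (xs ! 0)" for z xs
    by auto
  have "recursive 1 (\<lambda>xs. LEAST z. ?H (z # xs) = 0)"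
  proof (rule recursive_Least)
    show "recursive (Suc 1) ?H"
      unfolding g_def by (intro recursive_intros pq recursive_proj) auto
  qed (auto simp: H0)
  then show ?thesis
    unfolding computable_iff_recursive H0 grid_change_def floor by simp
qed

lemma computable_rat_seq_perturbed:
  assumes "computable_rat_seq a" and unit: "\<And>s. a s \<in> {0..1}"
  shows "computable_rat_seq (perturbed a)"
proof -
  obtain \<sigma> p q where p: "computable p" and q: "computable q" and q_pos: "\<And>s. q s > 0"
    and a_sgn: "\<And>s. a s = (- 1) ^ \<sigma> s * of_nat (p s) / of_nat (q s)"
    using assms(1) unfolding computable_rat_seq_def by blast
  have a: "a s = of_nat (p s) / of_nat (q s)" for s
    using unit[of s] q_pos[of s] unfolding a_sgn
    by (cases "even (\<sigma> s)") (auto simp: divide_le_0_iff)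
  define M where "M t = Suc (grid_change a (t div 2))" for t
  \<comment> \<open>Both kinds of entry are put over the denominator \<open>Q t\<close>. The factor
    \<open>1 - t mod 2\<close> is 1 at even \<open>t\<close> and 0 at odd \<open>t\<close>, and the
    outer \<open>min\<close> with \<open>Q t\<close> is the truncation at 1.\<close>
  define P where "P t = min (p (Suc (t div 2)) * M t + 3 * (1 - t mod 2) * q (Suc (t div 2)))
    (q (Suc (t div 2)) * M t)" for t
  define Q where "Q t = q (Suc (t div 2)) * M t" for t
  have comp: "recursive n (\<lambda>xs. p (F xs))" "recursive n (\<lambda>xs. q (F xs))"
    "recursive n (\<lambda>xs. grid_change a (F xs))" if "recursive n F" for n F
    using recursive_comp1[OF _ that] p q computable_grid_change[OF p q a]
    unfolding computable_iff_recursive by blast+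
  have "computable (\<lambda>_. 0)" "computable P" "computable Q"
    unfolding computable_iff_recursive P_def Q_def M_def
    by (intro recursive_intros comp recursive_proj; simp)+
  moreover have "Q t > 0" for t
    unfolding Q_def M_def using q_pos by simp
  moreover have "perturbed a t = (- 1) ^ 0 * of_nat (P t) / of_nat (Q t)" for t
  proof -
    define x y m where "x = p (Suc (t div 2))" and "y = q (Suc (t div 2))" and "m = M t"
    have pos: "y > 0" "m > 0"
      unfolding y_def m_def M_def using q_pos by auto
    have a_eq: "a (Suc (t div 2)) = of_nat x / of_nat y"
      unfolding x_def y_def by (rule a)
    \<comment> \<open>Hence the truncation in \<open>P\<close> changes nothing at odd indices, where
      \<open>perturbed\<close> has none.\<close>
    have le: "x \<le> y"
      using unit[of "Suc (t div 2)"] pos unfolding a_eq by (simp add: divide_le_eq)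
    have PQ: "P t = min (x * m + 3 * (1 - t mod 2) * y) (y * m)" "Q t = y * m"
      unfolding P_def Q_def x_def y_def m_def by simp_all
    have min_divide: "of_nat (min u v) / (of_nat v :: rat) = min 1 (of_nat u / of_nat v)"
      if "v > 0" for u v :: nat
      using that by (auto simp: min_def divide_simps)
    have "of_nat (P t) / of_nat (Q t) =
        min 1 (of_nat (x * m + 3 * (1 - t mod 2) * y) / (of_nat (y * m) :: rat))"
      unfolding PQ using pos by (intro min_divide) simp
    also have "of_nat (x * m + 3 * (1 - t mod 2) * y) / (of_nat (y * m) :: rat) =
        of_nat x / of_nat y + of_nat (3 * (1 - t mod 2)) / of_nat m"
      using pos by (simp add: field_simps)
    also have "min 1 \<dots> = perturbed a t"
    proof (cases "even t")
      case True
      then show ?thesis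
        unfolding perturbed_def Let_def a_eq m_def M_def by simp
    next
      case False
      then show ?thesis
        using le pos odd_iff_mod_2_eq_one[of t] unfolding perturbed_def Let_def a_eq by simp
    qed
    finally show ?thesis
      by simp
  qed
  ultimately show ?thesis
    unfolding computable_rat_seq_def by blast
qed

section \<open>Convergence and speed-up\<close>

lemma irrational_mult_of_nat_notin_Ints:
  fixes \<alpha> :: real
  assumes "\<alpha> \<notin> \<rat>" and "n > 0"
  shows "of_nat n * \<alpha> \<notin> \<int>"
proof
  assume "of_nat n * \<alpha> \<in> \<int>"
  then have "of_nat n * \<alpha> / of_nat n \<in> \<rat>"
    using Ints_subset_Rats by (intro Rats_divide) auto
  with assms show False
    by simp
qed

context
  fixes a :: "nat \<Rightarrow> rat" and \<alpha> :: real
  assumes lim: "(\<lambda>s. of_rat (a s)) \<longlonglongrightarrow> \<alpha>" and irrational: "\<alpha> \<notin> \<rat>"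
begin

text \<open>Irrationality enters here: \<alpha> is no grid point, and the floor is locally constant
  away from the integers.\<close>

lemma eventually_floor_mult_eq:
  assumes "n > 0"
  shows "\<forall>\<^sub>F s in sequentially. \<lfloor>of_nat n * a s\<rfloor> = \<lfloor>of_nat n * \<alpha>\<rfloor>"
proof -
  have "(\<lambda>s. of_nat n * of_rat (a s)) \<longlonglongrightarrow> of_nat n * \<alpha>"
    by (intro tendsto_intros lim)
  from eventually_floor_eq[OF this irrational_mult_of_nat_notin_Ints[OF irrational assms]]
  have "\<forall>\<^sub>F s in sequentially. \<lfloor>real_of_rat (of_nat n * a s)\<rfloor> = \<lfloor>of_nat n * \<alpha>\<rfloor>"
    by (simp add: of_rat_mult)
  then show ?thesis
    by (simp only: of_rat_floor)
qed

text \<open>For the finitely many meshes with \<open>n < N\<close>, both \<open>a s\<close> and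
  \<open>a (Suc s)\<close> eventually lie in the cell of \<alpha>, so no such \<open>n\<close> shows
  a change; \<open>N \<le> s\<close> keeps the cutoff from firing early.\<close>

lemma filterlim_grid_change: "filterlim (grid_change a) at_top sequentially"
  unfolding filterlim_at_top
proof
  fix N
  have "\<forall>\<^sub>F s in sequentially. \<forall>n\<in>{..<N}. \<lfloor>of_nat (Suc n) * a s\<rfloor> = \<lfloor>of_nat (Suc n) * \<alpha>\<rfloor>"
    by (intro eventually_ball_finite ballI eventually_floor_mult_eq) auto
  moreover from this have
    "\<forall>\<^sub>F s in sequentially. \<forall>n\<in>{..<N}. \<lfloor>of_nat (Suc n) * a (Suc s)\<rfloor> = \<lfloor>of_nat (Suc n) * \<alpha>\<rfloor>"
    by (subst (asm) eventually_sequentially_Suc[symmetric])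
  ultimately show "\<forall>\<^sub>F s in sequentially. N \<le> grid_change a s"
    using eventually_ge_at_top[of N]
  proof eventually_elim
    case (elim s)
    then show ?case
      using grid_change_cases[of s a] unfolding Let_def by (metis lessThan_iff not_le order.trans)
  qed
qed

lemma frequently_close:
  "\<exists>\<^sub>F s in sequentially. \<bar>\<alpha> - of_rat (a (Suc s))\<bar> \<le> 1 / real (Suc (grid_change a s))"
  unfolding frequently_sequentially
proof
  fix N
  define S where "S = {s. grid_change a s \<le> N}"
  have "finite S"
  proof -
    obtain s0 where "\<And>s. s \<ge> s0 \<Longrightarrow> Suc N \<le> grid_change a s"
      using filterlim_grid_change unfolding filterlim_at_top eventually_sequentially by blast
    then have "S \<subseteq> {..<s0}"
      unfolding S_def by (auto simp: not_le[symmetric] Suc_le_eq)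
    then show ?thesis
      by (rule finite_subset) simp
  qed
  define s where "s = Max S"
  \<comment> \<open>The cutoff at the stage pays off: stage \<open>N\<close> itself lies in
    \<open>S\<close>, so the last stage in \<open>S\<close> is at least \<open>N\<close>.\<close>
  have "N \<in> S"
    unfolding S_def by (simp add: grid_change_le)
  then have "N \<le> s" "s \<in> S"
    unfolding s_def using \<open>finite S\<close> Max_in by (auto intro: Max_ge)
  have step: "\<lfloor>of_nat (Suc N) * a (Suc t)\<rfloor> = \<lfloor>of_nat (Suc N) * a t\<rfloor>" if "s < t" for t
  proof -
    have "t \<notin> S"
      using that Max_ge[OF \<open>finite S\<close>, of t] unfolding s_def by (meson leD)
    then show ?thesis
      unfolding S_def by (intro floor_eq_if_less_grid_change) simp
  qed
  have const: "\<lfloor>of_nat (Suc N) * a t\<rfloor> = \<lfloor>of_nat (Suc N) * a (Suc s)\<rfloor>" if "Suc s \<le> t" for t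
    using that by (induction t rule: dec_induct) (use step in auto)
  obtain t where "Suc s \<le> t" and final: "\<lfloor>of_nat (Suc N) * a t\<rfloor> = \<lfloor>of_nat (Suc N) * \<alpha>\<rfloor>"
    using eventually_floor_mult_eq[of "Suc N"] unfolding eventually_sequentially
    by (metis max.cobounded1 max.cobounded2 zero_less_Suc)
  \<comment> \<open>No cell of mesh \<open>1 / Suc N\<close> is left after stage
    \<open>Suc s\<close>, so \<open>a (Suc s)\<close> already shares the cell of \<alpha>.\<close>
  have "\<lfloor>of_nat (Suc N) * \<alpha>\<rfloor> = \<lfloor>real_of_rat (of_nat (Suc N) * a (Suc s))\<rfloor>"
    unfolding of_rat_floor final[symmetric] by (rule const[OF \<open>Suc s \<le> t\<close>])
  then have "\<bar>real (Suc N) * \<alpha> - real (Suc N) * of_rat (a (Suc s))\<bar> < 1"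
    unfolding of_rat_mult of_rat_of_nat_eq by linarith
  then have "real (Suc N) * \<bar>\<alpha> - of_rat (a (Suc s))\<bar> < 1"
    by (simp only: right_diff_distrib[symmetric] abs_mult abs_of_nat)
  then have "\<bar>\<alpha> - of_rat (a (Suc s))\<bar> \<le> 1 / real (Suc N)"
    by (simp add: field_simps)
  also have "\<dots> \<le> 1 / real (Suc (grid_change a s))"
    using \<open>s \<in> S\<close> unfolding S_def by (intro divide_left_mono) auto
  finally show "\<exists>s\<ge>N. \<bar>\<alpha> - of_rat (a (Suc s))\<bar> \<le> 1 / real (Suc (grid_change a s))"
    using \<open>N \<le> s\<close> by blast
qed

lemma tendsto_perturbation:
  "(\<lambda>s. of_rat (a (Suc s)) + 3 / real (Suc (grid_change a s))) \<longlonglongrightarrow> \<alpha>"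
proof -
  have "(\<lambda>n. 3 / real (Suc n)) \<longlonglongrightarrow> 0"
    using tendsto_mult_right_zero[OF LIMSEQ_inverse_real_of_nat, of 3] by (simp add: divide_inverse)
  then have "(\<lambda>s. 3 / real (Suc (grid_change a s))) \<longlonglongrightarrow> 0"
    by (rule filterlim_compose[OF _ filterlim_grid_change])
  from tendsto_add[OF LIMSEQ_Suc[OF lim] this] show ?thesis
    by simp
qed

lemma of_rat_perturbed:
  "real_of_rat (perturbed a t) = (let s = t div 2 in
    if even t then min 1 (of_rat (a (Suc s)) + 3 / real (Suc (grid_change a s)))
    else of_rat (a (Suc s)))"
proof -
  have of_rat_min: "real_of_rat (min x y) = min (of_rat x) (of_rat y)" for x y
    by (simp add: min_def of_rat_less_eq)
  have "real_of_rat (3 / of_nat n) = 3 / real n" for n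
    by (simp add: of_rat_divide)
  then show ?thesis
    unfolding perturbed_def Let_def by (simp only: of_rat_min of_rat_add of_rat_1 split: if_split) simp
qed

lemma tendsto_perturbed:
  assumes "\<alpha> < 1"
  shows "(\<lambda>t. of_rat (perturbed a t)) \<longlonglongrightarrow> \<alpha>"
proof -
  have div2: "filterlim (\<lambda>t::nat. t div 2) at_top sequentially"
    by (rule filterlim_at_top_div_const_nat) simp
  have "(\<lambda>s. min 1 (of_rat (a (Suc s)) + 3 / real (Suc (grid_change a s)))) \<longlonglongrightarrow> min 1 \<alpha>"
    by (intro tendsto_min tendsto_const tendsto_perturbation)
  \<comment> \<open>The limit \<open>min 1 \<alpha>\<close> is \<alpha> because
    \<open>\<alpha> < 1\<close>.\<close>
  then have "(\<lambda>t. min 1 (of_rat (a (Suc (t div 2))) + 3 / real (Suc (grid_change a (t div 2))))) \<longlonglongrightarrow> \<alpha>"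
    using assms by (intro filterlim_compose[OF _ div2]) (simp add: min_def)
  moreover have "(\<lambda>t. of_rat (a (Suc (t div 2)))) \<longlonglongrightarrow> \<alpha>"
    by (rule filterlim_compose[OF LIMSEQ_Suc[OF lim] div2])
  \<comment> \<open>Each branch converges along all \<open>t\<close>, hence along the indices of its
    own parity.\<close>
  ultimately show ?thesis
    unfolding of_rat_perturbed Let_def by (intro filterlim_If; elim filterlim_mono) auto
qed

lemma frequently_halved:
  assumes "\<alpha> < 1"
  shows "\<exists>\<^sub>F t in sequentially.
    \<bar>(\<alpha> - of_rat (perturbed a (Suc t))) / (\<alpha> - of_rat (perturbed a t))\<bar> \<le> 1 / 2"
  unfolding frequently_sequentially
proof
  fix N
  have "\<forall>\<^sub>F s in sequentially. of_rat (a (Suc s)) + 3 / real (Suc (grid_change a s)) < 1"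
    using order_tendstoD(2)[OF tendsto_perturbation assms] .
  with frequently_close have
    "\<exists>\<^sub>F s in sequentially. \<bar>\<alpha> - of_rat (a (Suc s))\<bar> \<le> 1 / real (Suc (grid_change a s)) \<and>
      of_rat (a (Suc s)) + 3 / real (Suc (grid_change a s)) < 1"
    by (rule frequently_eventually_frequently)
  then obtain s where "N \<le> s"
    and close: "\<bar>\<alpha> - of_rat (a (Suc s))\<bar> \<le> 1 / real (Suc (grid_change a s))"
    and less: "of_rat (a (Suc s)) + 3 / real (Suc (grid_change a s)) < 1"
    unfolding frequently_sequentially by blast
  define e where "e = 1 / real (Suc (grid_change a s))"
  have "e > 0"
    unfolding e_def by simp
  \<comment> \<open>By \<open>less\<close> the truncation at 1 is inactive here; such stages exist
    because the shifted values tend to \<open>\<alpha> < 1\<close>.\<close>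
  have "of_rat (perturbed a (2 * s)) = of_rat (a (Suc s)) + 3 * e"
    using less unfolding of_rat_perturbed e_def by simp
  moreover have "of_rat (perturbed a (Suc (2 * s))) = real_of_rat (a (Suc s))"
    unfolding of_rat_perturbed by simp
  \<comment> \<open>This explains the constant 3: a shift by \<open>3 * e\<close> from a point
    within \<open>e\<close> of \<alpha> ends at distance at least \<open>2 * e\<close>, twice the
    distance bound \<open>e\<close> for the unshifted value.\<close>
  ultimately have "\<bar>\<alpha> - of_rat (perturbed a (Suc (2 * s)))\<bar> \<le> e"
    and "2 * e \<le> \<bar>\<alpha> - of_rat (perturbed a (2 * s))\<bar>"
    using close unfolding e_def[symmetric] by linarith+
  then have "\<bar>(\<alpha> - of_rat (perturbed a (Suc (2 * s)))) / (\<alpha> - of_rat (perturbed a (2 * s)))\<bar> \<le> 1 / 2"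
    using \<open>e > 0\<close> unfolding abs_divide by (simp add: divide_le_eq)
  then show "\<exists>t\<ge>N. \<bar>(\<alpha> - of_rat (perturbed a (Suc t))) / (\<alpha> - of_rat (perturbed a t))\<bar> \<le> 1 / 2"
    using \<open>N \<le> s\<close> by (intro exI[of _ "2 * s"]) auto
qed

end

text \<open>A limit inferior above \<open>c\<close> would put \<open>f\<close> above
  \<open>c\<close> eventually. This turns infinitely many halvings into the bound that speedability
  asks for.\<close>

lemma Liminf_le_if_frequently:
  fixes c :: "'a :: complete_linorder"
  assumes "\<exists>\<^sub>F x in F. f x \<le> c"
  shows "Liminf F f \<le> c"
proof (rule ccontr)
  assume "\<not> Liminf F f \<le> c"
  then have "\<forall>\<^sub>F x in F. c < f x"
    by (intro less_LiminfD) simp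
  with assms show False
    by (simp add: frequently_def not_le)
qed

lemma perturbed_in_unit_interval:
  assumes "\<And>s. a s \<in> {0..1}"
  shows "perturbed a t \<in> {0..1}"
  using assms[of "Suc (t div 2)"] unfolding perturbed_def Let_def by auto

theorem corollary3p3:
  fixes \<alpha> :: real
  assumes "\<alpha> \<in> {0<..<1}"
    and "computably_approximable \<alpha>"
  shows "ca_speedable \<alpha>"
proof -
  obtain a where a: "computable_approximation a \<alpha>"
    using assms(2) unfolding computably_approximable_def by blast
  then have unit: "\<And>s. a s \<in> {0..1}" and lim: "(\<lambda>s. of_rat (a s)) \<longlonglongrightarrow> \<alpha>"
    and comp: "computable_rat_seq a"
    unfolding computable_approximation_def approximation_def by auto
  show ?thesis
  proof (cases "\<alpha> \<in> \<rat>")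
    case True
    \<comment> \<open>For rational \<alpha> speedability holds by definition, so the given
      approximation serves and 0 is an arbitrary choice.\<close>
    then have "rho_speedable 0 a \<alpha>"
      unfolding rho_speedable_def by blast
    with a show ?thesis
      unfolding ca_speedable_def speedable_def by (metis atLeastLessThan_iff order.refl zero_less_one)
  next
    case False
    have "\<alpha> < 1"
      using assms(1) by simp
    have "computable_approximation (perturbed a) \<alpha>"
      unfolding computable_approximation_def approximation_def
      using perturbed_in_unit_interval[of a, OF unit] tendsto_perturbed[OF lim False \<open>\<alpha> < 1\<close>]
        computable_rat_seq_perturbed[OF comp unit] by blast
    moreover have "computable_order Suc"
      unfolding computable_order_def computable_iff_recursive
      by (auto intro!: recursive_Suc recursive_proj simp: mono_def intro: le_SucI)
    moreover have "liminf (\<lambda>t. ereal \<bar>(\<alpha> - of_rat (perturbed a (Suc t))) / (\<alpha> - of_rat (perturbed a t))\<bar>)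
        \<le> ereal (of_rat (1 / 2))"
      using frequently_halved[OF lim False \<open>\<alpha> < 1\<close>]
      by (intro Liminf_le_if_frequently) (simp add: of_rat_divide)
    ultimately have "rho_speedable (1 / 2) (perturbed a) \<alpha>"
      unfolding rho_speedable_def using False by blast
    then have "speedable (perturbed a) \<alpha>"
      unfolding speedable_def by (intro bexI[of _ "1 / 2"]) auto
    with \<open>computable_approximation (perturbed a) \<alpha>\<close> show ?thesis
      unfolding ca_speedable_def by blast
  qed
qed

end
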